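(* Let $n\geq 2$ and let $l=3^m2^s l_1$ be a positive integer with $m,s\geq 0$ and $\gcd(3,l_1)=\gcd(2,l_1)=1$. Then: (1) if $s\geq 2$, $$\varepsilon_2(n,l)=\sum_{L\in\Gamma_1(l)}(-1)^{|L|+1}n^{\frac{3l}{\mathfrak{p}(L)}},$$ where $\Gamma_1(l)=\{L\subseteq\{3,4\}\cup\mathfrak{pf}(l_1)\ :\ L\neq\emptyset,\ L\neq\{3\}\}$; (2) if $s\leq 1$, $$\varepsilon_2(n,l)=\sum_{L\in\Gamma_2(l)}(-1)^{|L|+1}n^{\frac{3l}{\mathfrak{p}(L)}},$$ where $\Gamma_2(l)=\{L\subseteq\{3\}\cup\mathfrak{pf}(l_1)\ :\ L\neq\emptyset,\ L\neq\{3\}\}$.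
   Context: For a finite set $L$ of positive integers, $\mathfrak{p}(L)$ is the product of its elements ($\mathfrak{p}(\emptyset)=1$), and $\mathfrak{pf}(k)$ is the set of prime factors of $k$. A nonempty word $u$ is primitive if $u=v^m$ with $m$ a positive integer implies $m=1$; $|u|$ is its length. For an alphabet $\mathcal{A}$ of size $n$, $\varepsilon_2(n,l)$ is the number of pairs $(p,q)$ of primitive words over $\mathcal{A}$ with $|p|=2|q|=2l$, $pq$ not primitive, for which there exist nonempty words $\alpha,\beta$ and an integer $s'\geq1$ with $\alpha\beta$ primitive, $q=(\alpha\beta)^{s'}\alpha$, and either ($p=(\beta\alpha)^{2s'}\beta$ and $|\beta|=2|\alpha|$) or ($p=(\beta\alpha)^{2s'+1}\beta$ and $|\alpha|=2|\beta|$). *)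

theory Defs
  imports "HOL-Computational_Algebra.Primes"
begin

text \<open>A word over an alphabet \<open>A\<close> is a list in \<^term>\<open>lists A\<close>.\<close>

definition word_power :: "'a list \<Rightarrow> nat \<Rightarrow> 'a list" where
  "word_power v m = concat (replicate m v)"

definition primitive_word :: "'a list \<Rightarrow> bool" where
  "primitive_word u \<longleftrightarrow> u \<noteq> [] \<and> (\<forall>v m. m \<ge> 1 \<longrightarrow> u = word_power v m \<longrightarrow> m = 1)"

definition eps2_pairs :: "'a set \<Rightarrow> nat \<Rightarrow> ('a list \<times> 'a list) set" where
  "eps2_pairs A l = {(p, q). p \<in> lists A \<and> q \<in> lists A \<and>
     primitive_word p \<and> primitive_word q \<and>
     length p = 2 * length q \<and> length q = l \<and>
     \<not> primitive_word (p @ q) \<and>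
     (\<exists>\<alpha> \<beta> s'. \<alpha> \<in> lists A \<and> \<beta> \<in> lists A \<and> \<alpha> \<noteq> [] \<and> \<beta> \<noteq> [] \<and> s' \<ge> 1 \<and>
        primitive_word (\<alpha> @ \<beta>) \<and>
        q = word_power (\<alpha> @ \<beta>) s' @ \<alpha> \<and>
        ((p = word_power (\<beta> @ \<alpha>) (2 * s') @ \<beta> \<and> length \<beta> = 2 * length \<alpha>) \<or>
         (p = word_power (\<beta> @ \<alpha>) (2 * s' + 1) @ \<beta> \<and> length \<alpha> = 2 * length \<beta>)))}"

definition eps2 :: "'a set \<Rightarrow> nat \<Rightarrow> nat" where
  "eps2 A l = card (eps2_pairs A l)"

text \<open>The index families depend on \<open>l = 3^m * 2^s * l1\<close> only through its part \<open>l1\<close>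
  coprime to \<open>6\<close>, which is their argument here.\<close>

definition Gamma1 :: "nat \<Rightarrow> nat set set" where
  "Gamma1 l1 = {L. L \<subseteq> {3, 4} \<union> prime_factors l1 \<and> L \<noteq> {} \<and> L \<noteq> {3}}"

definition Gamma2 :: "nat \<Rightarrow> nat set set" where
  "Gamma2 l1 = {L. L \<subseteq> {3} \<union> prime_factors l1 \<and> L \<noteq> {} \<and> L \<noteq> {3}}"

end

theory Submission imports Defs begin

text \<open>
  Write \<open>e(w)\<close> for the exponent of \<open>w\<close>, i.e. \<open>w = t\<^sup>e\<close> with \<open>t\<close> primitive; by Fine and Wilf it is
  unique, and \<open>w\<close> is an \<open>x\<close>-th power iff \<open>x dvd e(w)\<close>. The shapes of \<open>p\<close> and \<open>q\<close> give
  \<open>pq = (\<beta>\<alpha>)\<^sup>k\<close> with \<open>k = 3s' + 1\<close> or \<open>k = 3s' + 2\<close>, and the primitivity of \<open>p\<close> and \<open>q\<close> is automatic,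
  again by Fine and Wilf. So \<open>(p, q) \<mapsto> pq\<close> is a bijection onto the words \<open>w\<close> of length \<open>3l\<close>
  with \<open>e(w) \<ge> 4\<close> and \<open>\<not> 3 dvd e(w)\<close>. As \<open>e(w)\<close> divides \<open>3l\<close>, the first condition says that
  \<open>e(w)\<close> is divisible by \<open>4\<close> or by a prime factor of \<open>l1\<close>. Inclusion-exclusion counts these words:
  for the set \<open>D\<close> of all \<open>x\<close> in the index set dividing \<open>e(w)\<close>, the signs of the nonempty
  \<open>L \<subseteq> D\<close> other than \<open>{3}\<close> add up to \<open>1\<close> if \<open>3 \<notin> D \<noteq> {}\<close> and to \<open>0\<close> otherwise.
\<close>

section \<open>Periods\<close>

text \<open>Stated through residues, and for a function on the first \<open>n\<close> positions
  instead of a list, so that passing to a prefix only lowers \<open>n\<close>.\<close>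

definition periodic_upto :: "(nat \<Rightarrow> 'a) \<Rightarrow> nat \<Rightarrow> nat \<Rightarrow> bool" where
  "periodic_upto f n p \<longleftrightarrow> (\<forall>i<n. \<forall>j<n. i mod p = j mod p \<longrightarrow> f i = f j)"

lemma periodic_uptoD:
  "periodic_upto f n p \<Longrightarrow> i < n \<Longrightarrow> j < n \<Longrightarrow> i mod p = j mod p \<Longrightarrow> f i = f j"
  unfolding periodic_upto_def by blast

lemma periodic_upto_mono: "periodic_upto f n p \<Longrightarrow> m \<le> n \<Longrightarrow> periodic_upto f m p"
  unfolding periodic_upto_def by (meson less_le_trans)

lemma periodic_uptoI_shift:
  assumes "p > 0" and "\<And>i. i + p < n \<Longrightarrow> f i = f (i + p)"
  shows "periodic_upto f n p"
proof -
  have "i < n \<longrightarrow> f i = f (i mod p)" for i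
  proof (induction i rule: less_induct)
    case (less i)
    show ?case
    proof (cases "i < p")
      case False
      then show ?thesis
        using less[of "i - p"] assms(1) assms(2)[of "i - p"] by (auto simp: le_mod_geq)
    qed simp
  qed
  then show ?thesis by (metis periodic_upto_def)
qed

text \<open>Subtractive Euclidean algorithm: periods \<open>a > b\<close> on \<open>n\<close>
  positions give periods \<open>a - b\<close> and \<open>b\<close> on the first
  \<open>n - b\<close>, with the same gcd and still enough length. The period \<open>gcd a b\<close>
  found there spreads to all \<open>n\<close> positions by reduction modulo
  \<open>b\<close>.\<close>

theorem Fine_Wilf:
  assumes "p > 0" "q > 0" "periodic_upto f n p" "periodic_upto f n q" "p + q \<le> n + gcd p q"
  shows "periodic_upto f n (gcd p q)"
  using assms
proof (induction "p + q" arbitrary: p q n rule: less_induct)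
  case less
  have reduce: "periodic_upto f n (gcd a b)"
    if ab: "b < a" "b > 0" "a + b = p + q" "periodic_upto f n a" "periodic_upto f n b"
      "a + b \<le> n + gcd a b" for a b
  proof -
    let ?g = "gcd a b"
    have g: "gcd (a - b) b = ?g"
      using ab(1) by (simp add: gcd_diff1_nat)
    have "?g \<le> a - b"
      using ab(1) g by (metis gcd_le1_nat zero_less_diff less_numeral_extra(3))
    \<comment> \<open>The gcd is at most \<open>a - b\<close>, which gives the first inequality from
      the length bound, and at most \<open>b\<close>, which gives the second.\<close>
    then have n: "b + b \<le> n" and ban: "a \<le> n"
      using ab gcd_le2_nat[of b a] by linarith+
    have "periodic_upto f (n - b) (a - b)"
    proof (rule periodic_uptoI_shift)
      fix i assume i: "i + (a - b) < n - b"
      \<comment> \<open>Forward by \<open>a\<close>, then back by \<open>b\<close>;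
        \<open>i + a\<close> stays below \<open>n\<close>.\<close>
      have "f i = f (i + a)"
        using ab(4) by (rule periodic_uptoD) (use i ab(1) in auto)
      moreover have "(i + (a - b)) mod b = (i + a) mod b"
        using ab(1) by (metis add.assoc le_add_diff_inverse2 less_imp_le mod_add_self2)
      then have "f (i + (a - b)) = f (i + a)"
        by (intro periodic_uptoD[OF ab(5)]) (use i ab(1) in auto)
      ultimately show "f i = f (i + (a - b))" by simp
    qed (use ab in simp)
    moreover have "periodic_upto f (n - b) b"
      using ab(5) by (rule periodic_upto_mono) simp
    ultimately have pre: "periodic_upto f (n - b) ?g"
      using less.hyps[of "a - b" b "n - b"] ab g by simp
    show ?thesis
      unfolding periodic_upto_def
    proof (intro allI impI)
      fix i j assume ij: "i < n" "j < n" "i mod ?g = j mod ?g"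
      \<comment> \<open>Residues modulo \<open>b\<close> fall into the prefix on which the period
        \<open>?g\<close> is already known.\<close>
      have small: "k mod b < n - b" for k
        using mod_less_divisor[OF ab(2), of k] n by linarith
      then have small': "k mod b < n" for k
        by (meson diff_le_self less_le_trans)
      have "f i = f (i mod b)" "f j = f (j mod b)"
        using ij small' by (auto intro: periodic_uptoD[OF ab(5)])
      moreover have "f (i mod b) = f (j mod b)"
        by (rule periodic_uptoD[OF pre small small]) (use ij in \<open>simp add: mod_mod_cancel\<close>)
      ultimately show "f i = f j" by simp
    qed
  qed
  show ?case
  proof (cases p q rule: linorder_cases)
    case less
    then show ?thesis using reduce[of p q] less.prems by (simp add: gcd.commute add.commute)
  next
    case equal
    then show ?thesis using less.prems by simp
  next
    case greater
    then show ?thesis using reduce[of q p] less.prems by simp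
  qed
qed

section \<open>Powers and primitive words\<close>

lemma word_power_0 [simp]: "word_power v 0 = []"
  by (simp add: word_power_def)

lemma word_power_Suc [simp]: "word_power v (Suc m) = v @ word_power v m"
  by (simp add: word_power_def)

lemma word_power_1 [simp]: "word_power v 1 = v"
  by (simp add: word_power_def)

lemma word_power_add: "word_power v (i + j) = word_power v i @ word_power v j"
  by (induction i) auto

lemma word_power_mult: "word_power v (i * j) = word_power (word_power v i) j"
  by (induction j) (auto simp: word_power_add)

lemma length_word_power [simp]: "length (word_power v m) = m * length v"
  by (induction m) auto

lemma word_power_in_lists [simp]:
  "m > 0 \<Longrightarrow> word_power v m \<in> lists A \<longleftrightarrow> v \<in> lists A"
  by (auto simp: word_power_def)

lemma word_power_swap: "v @ word_power (u @ v) k = word_power (v @ u) k @ v"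
  by (induction k) auto

lemma nth_word_power: "i < k * length v \<Longrightarrow> word_power v k ! i = v ! (i mod length v)"
proof (induction k arbitrary: i)
  case (Suc k)
  then show ?case by (cases "i < length v") (auto simp: nth_append le_mod_geq)
qed simp

lemma periodic_word_power: "periodic_upto ((!) (word_power v k)) (k * length v) (length v)"
  by (auto simp: periodic_upto_def nth_word_power)

lemma word_eq_power_take:
  assumes "periodic_upto ((!) u) (length u) g" "g > 0" "g dvd length u"
  shows "u = word_power (take g u) (length u div g)"
proof (cases "u = []")
  case False
  then have g: "g \<le> length u" using assms by (simp add: dvd_imp_le)
  show ?thesis
  proof (rule nth_equalityI)
    show len: "length u = length (word_power (take g u) (length u div g))"
      using g assms by (simp add: min_absorb2)
    fix i assume i: "i < length u"
    have m: "i mod g < g" using assms by simp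
    have "u ! i = u ! (i mod g)"
      by (rule periodic_uptoD[OF assms(1)]) (use i m g in auto)
    then show "u ! i = word_power (take g u) (length u div g) ! i"
      using i g m len by (subst nth_word_power) (simp_all add: min_absorb2)
  qed
qed simp

text \<open>Brings primitivity into the form to which Fine and Wilf applies: a period dividing the
  length cuts \<open>u\<close> into equal blocks, and a power has the length of its base as such a
  period.\<close>

lemma primitive_word_iff_period:
  "primitive_word u \<longleftrightarrow>
     u \<noteq> [] \<and> (\<forall>g. g dvd length u \<longrightarrow> periodic_upto ((!) u) (length u) g \<longrightarrow> g = length u)"
proof (cases "u = []")
  case False
  show ?thesis
  proof
    assume P: "primitive_word u"
    have "g = length u" if "g dvd length u" "periodic_upto ((!) u) (length u) g" for g
    proof -
      have "g > 0" using that False by (cases g) auto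
      moreover have "length u div g \<ge> 1"
        using that False \<open>g > 0\<close> by (simp add: dvd_imp_le div_greater_zero_iff Suc_leI)
      ultimately have "length u div g = 1"
        using word_eq_power_take[OF that(2) _ that(1)] P unfolding primitive_word_def by blast
      then show ?thesis using that by (metis dvd_div_mult_self mult_1)
    qed
    with False show "u \<noteq> [] \<and> (\<forall>g. g dvd length u \<longrightarrow> periodic_upto ((!) u) (length u) g \<longrightarrow> g = length u)"
      by blast
  next
    assume R: "u \<noteq> [] \<and> (\<forall>g. g dvd length u \<longrightarrow> periodic_upto ((!) u) (length u) g \<longrightarrow> g = length u)"
    have "m = 1" if "m \<ge> 1" "u = word_power v m" for v m
    proof -
      have "length v = length u"
        using R that periodic_word_power[of v m] by (metis length_word_power dvd_triv_right)
      then show ?thesis using arg_cong[OF that(2), of length] False by auto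
    qed
    with R show "primitive_word u" by (auto simp: primitive_word_def)
  qed
qed (simp add: primitive_word_def)

text \<open>\<open>u @ v\<close> is \<open>v @ u\<close> read cyclically from position
  \<open>length v\<close>. A period that divides the total length is not disturbed by reducing
  positions modulo that length, so it survives the rotation.\<close>

lemma primitive_word_swap:
  assumes "primitive_word (u @ v)"
  shows "primitive_word (v @ u)"
  unfolding primitive_word_iff_period
proof (intro conjI allI impI)
  let ?n = "length (v @ u)"
  show "v @ u \<noteq> []" using assms by (auto simp: primitive_word_def)
  fix g assume g: "g dvd ?n" "periodic_upto ((!) (v @ u)) ?n g"
  have n0: "?n > 0" using assms by (auto simp: primitive_word_def)
  have rot: "(u @ v) ! i = (v @ u) ! ((i + length v) mod ?n)" if "i < ?n" for i
  proof (cases "i < length u")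
    case True
    then show ?thesis using that by (simp add: nth_append)
  next
    case False
    then have "(i + length v) mod ?n = i - length u"
      using that by (simp add: le_mod_geq)
    moreover have "i - length u < length v" using False that by simp
    ultimately show ?thesis using False by (simp add: nth_append)
  qed
  have "periodic_upto ((!) (u @ v)) ?n g"
    unfolding periodic_upto_def
  proof (intro allI impI)
    fix i j assume ij: "i < ?n" "j < ?n" "i mod g = j mod g"
    have "(i + length v) mod ?n mod g = (j + length v) mod ?n mod g"
      using ij(3) g(1) by (metis mod_mod_cancel mod_add_cong)
    then have "(v @ u) ! ((i + length v) mod ?n) = (v @ u) ! ((j + length v) mod ?n)"
      using periodic_uptoD[OF g(2)] n0 by (meson mod_less_divisor)
    then show "(u @ v) ! i = (u @ v) ! j" using rot ij by simp
  qed
  then show "g = ?n"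
    using assms g(1) unfolding primitive_word_iff_period by (simp add: add.commute)
qed

text \<open>By Fine and Wilf the gcd of the two periods is a period of \<open>w\<close>, hence of
  its prefix \<open>t\<close>. It divides \<open>length t\<close>, so primitivity of
  \<open>t\<close> makes it equal to \<open>length t\<close>.\<close>

lemma primitive_prefix_dvd_period:
  assumes "primitive_word t" "take (length t) w = t" "p > 0"
    and "periodic_upto ((!) w) (length w) (length t)" "periodic_upto ((!) w) (length w) p"
    and "length t + p \<le> length w + gcd (length t) p"
  shows "length t dvd p"
proof -
  have t: "t \<noteq> []" using assms(1) by (simp add: primitive_word_def)
  have "length t \<le> length w" using assms(2) by (metis nat_le_linear take_all)
  then have "periodic_upto ((!) w) (length t) (gcd (length t) p)"
    using Fine_Wilf[of "length t" p] assms t by (meson length_greater_0_conv periodic_upto_mono)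
  moreover have "w ! i = t ! i" if "i < length t" for i
    using that assms(2) by (metis nth_take)
  ultimately have "periodic_upto ((!) t) (length t) (gcd (length t) p)"
    unfolding periodic_upto_def by metis
  then have "gcd (length t) p = length t"
    using assms(1) unfolding primitive_word_iff_period by simp
  then show ?thesis by (metis gcd_dvd2)
qed

section \<open>Primitive roots and exponents\<close>

lemma primitive_root_exists:
  assumes "w \<noteq> []"
  obtains t k where "primitive_word t" "k > 0" "w = word_power t k"
proof -
  have "\<exists>t k. primitive_word t \<and> k > 0 \<and> w = word_power t k"
    using assms
  proof (induction w rule: length_induct)
    case (1 w)
    show ?case
    proof (cases "primitive_word w")
      case True
      then show ?thesis by (intro exI[of _ w] exI[of _ 1]) simp
    next
      case False
      then obtain v m where vm: "m \<ge> 1" "w = word_power v m" "m \<noteq> 1"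
        using 1 by (auto simp: primitive_word_def)
      have "length w = m * length v" using vm(2) by simp
      moreover have "w \<noteq> []" "m \<ge> 2" using 1 vm by auto
      ultimately have "v \<noteq> []" "length v < length w" by auto
      then obtain t k where "primitive_word t" "k > 0" "v = word_power t k"
        using 1 by blast
      then show ?thesis using vm by (intro exI[of _ t] exI[of _ "k * m"]) (simp add: word_power_mult)
    qed
  qed
  then show thesis using that by blast
qed

text \<open>If \<open>k\<close> and \<open>x\<close> are both at least 2, then \<open>t\<close> and
  \<open>v\<close> each fill at most half of the word, so Fine and Wilf makes
  \<open>length t\<close> divide \<open>length v\<close>; comparing lengths gives
  \<open>x dvd k\<close>. For \<open>k = 1\<close> primitivity of \<open>t\<close> forces
  \<open>x = 1\<close>.\<close>

lemma is_power_iff_dvd: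
  assumes "primitive_word t" "k > 0" "x > 0"
  shows "(\<exists>v. word_power t k = word_power v x) \<longleftrightarrow> x dvd k"
proof
  assume "x dvd k"
  then obtain c where "k = c * x" by (metis dvd_def mult.commute)
  then show "\<exists>v. word_power t k = word_power v x" by (auto simp: word_power_mult)
next
  assume "\<exists>v. word_power t k = word_power v x"
  then obtain v where v: "word_power t k = word_power v x" by blast
  have t: "t \<noteq> []" using assms(1) by (simp add: primitive_word_def)
  have len: "k * length t = x * length v" using v by (metis length_word_power)
  show "x dvd k"
  proof (cases "k = 1 \<or> x = 1")
    case True
    then show ?thesis using assms v by (auto simp: primitive_word_def)
  next
    case False
    then have "k \<ge> 2" "x \<ge> 2" using assms by auto
    then have "2 * length t \<le> k * length t" "2 * length v \<le> k * length t"
      using mult_le_mono1[of 2 k "length t"] mult_le_mono1[of 2 x "length v"] len by linarith+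
    then have "length t + length v \<le> k * length t + gcd (length t) (length v)"
      by linarith
    moreover have "v \<noteq> []" using len assms t by auto
    moreover have "take (length t) (word_power t k) = t"
      using \<open>k > 0\<close> by (cases k) auto
    ultimately have "length t dvd length v"
      using periodic_word_power[of t k] periodic_word_power[of v x] assms v len
      by (intro primitive_prefix_dvd_period[of t "word_power t k"]) auto
    then obtain c where "length v = length t * c" by (auto simp: dvd_def)
    then have "k = x * c" using len t by simp
    then show ?thesis by simp
  qed
qed

text \<open>The choice is unique by \<open>word_exponent_word_power\<close>. The empty word is no
  positive power of a primitive word, so its value is unspecified.\<close>

definition word_exponent :: "'a list \<Rightarrow> nat" where
  "word_exponent w = (SOME k. k > 0 \<and> (\<exists>t. primitive_word t \<and> w = word_power t k))"

lemma primitive_root: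
  assumes "w \<noteq> []"
  obtains t where "primitive_word t" "word_exponent w > 0" "w = word_power t (word_exponent w)"
proof -
  have "\<exists>k. k > 0 \<and> (\<exists>t. primitive_word t \<and> w = word_power t k)"
    using primitive_root_exists[OF assms] by metis
  from someI_ex[OF this] show thesis
    using that unfolding word_exponent_def[symmetric] by blast
qed

lemma is_power_iff_dvd_exponent:
  assumes "w \<noteq> []" "x > 0"
  shows "(\<exists>v. w = word_power v x) \<longleftrightarrow> x dvd word_exponent w"
proof -
  obtain t where "primitive_word t" "word_exponent w > 0" "w = word_power t (word_exponent w)"
    using primitive_root[OF assms(1)] .
  then show ?thesis using is_power_iff_dvd[of t "word_exponent w" x] assms(2) by simp
qed

text \<open>Both numbers have the same positive divisors, since these are the \<open>x\<close> for
  which the word is an \<open>x\<close>-th power.\<close>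

lemma word_exponent_word_power:
  assumes "primitive_word t" "k > 0"
  shows "word_exponent (word_power t k) = k"
proof -
  let ?w = "word_power t k"
  have w: "?w \<noteq> []" using assms by (auto simp: word_power_def primitive_word_def)
  then have "word_exponent ?w > 0" using primitive_root by blast
  then have "x dvd k \<longleftrightarrow> x dvd word_exponent ?w" if "x > 0" for x
    using is_power_iff_dvd[OF assms that] is_power_iff_dvd_exponent[OF w that] by blast
  then show ?thesis
    using assms(2) \<open>word_exponent ?w > 0\<close> by (meson dvd_antisym dvd_refl)
qed

section \<open>Primitivity of fractional powers\<close>

text \<open>\<open>w\<close> is a prefix of the full power \<open>word_power (u @ v) (m + 1)\<close>
  and inherits its period.\<close>

lemma fractional_power_period:
  fixes u v :: "'a list"
  assumes "m \<ge> 1"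
  defines "w \<equiv> word_power (u @ v) m @ u"
  shows "take (length (u @ v)) w = u @ v"
    and "periodic_upto ((!) w) (length w) (length (u @ v))"
proof -
  show "take (length (u @ v)) w = u @ v"
    using assms by (cases m) auto
  have "word_power (u @ v) (m + 1) = w @ v"
    by (simp only: word_power_add word_power_1 w_def append_assoc)
  then have "periodic_upto ((!) (w @ v)) (length (w @ v)) (length (u @ v))"
    using periodic_word_power[of "u @ v" "m + 1"] by (metis length_word_power)
  then have "periodic_upto ((!) (w @ v)) (length w) (length (u @ v))"
    by (rule periodic_upto_mono) simp
  then show "periodic_upto ((!) w) (length w) (length (u @ v))"
    unfolding periodic_upto_def by (metis nth_append)
qed

text \<open>A proper power \<open>z^j\<close> would have the periods \<open>3 * a\<close> and
  \<open>length z\<close>. By Fine and Wilf \<open>3 * a\<close> then divides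
  \<open>length z\<close>, hence the total length \<open>r * a\<close>, against
  \<open>\<not> 3 dvd r\<close>. The parameter \<open>r\<close> lets one lemma serve both components
  of a pair.\<close>

lemma primitive_fractional_power:
  assumes prim: "primitive_word (u @ v)" and "m \<ge> 1" and "length (u @ v) = 3 * a"
    and "length (word_power (u @ v) m @ u) = r * a" and "\<not> 3 dvd r"
  shows "primitive_word (word_power (u @ v) m @ u)"
proof -
  let ?w = "word_power (u @ v) m @ u"
  have uv: "u @ v \<noteq> []" using prim by (simp add: primitive_word_def)
  then have a: "a > 0" using assms(3) by (cases a) auto
  have len: "length ?w = m * (3 * a) + length u"
    using assms(3) by simp
  have "3 * a \<le> m * (3 * a)" using \<open>m \<ge> 1\<close> by simp
  then have "3 * a \<le> r * a" using len assms(4) by linarith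
  then have "3 \<le> r" using a by simp
  then have r: "r \<ge> 4" using assms(5) by (cases "r = 3") auto
  have "j = 1" if j: "j \<ge> 1" "?w = word_power z j" for z j
  proof (rule ccontr)
    assume "j \<noteq> 1"
    then have j2: "j \<ge> 2" using j by simp
    let ?z = "length z"
    have jz: "r * a = j * ?z" using assms(4) j(2) by (metis length_word_power)
    then have z: "?z > 0" using a r by (cases "?z = 0") auto
    \<comment> \<open>For \<open>r \<le> 5\<close> and small \<open>j\<close> the bound holds only thanks to the gcd term of Fine and Wilf.\<close>
    have "3 * a + ?z \<le> r * a + gcd (3 * a) ?z"
    proof -
      consider "r \<ge> 6" | "r = 4" "j \<ge> 4" | "r = 5" "j \<ge> 3" | "r = 4" "j = 2" | "r = 4" "j = 3"
        | "r = 5" "j = 2"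
        using r j2 by linarith
      then show ?thesis
      proof cases
        case 1
        have "6 * a \<le> r * a" "2 * ?z \<le> j * ?z" using 1 j2 by simp_all
        then show ?thesis using jz by linarith
      next
        case 2
        have "4 * ?z \<le> j * ?z" using 2 by simp
        moreover have "r * a = 4 * a" using 2 by simp
        ultimately show ?thesis using jz by linarith
      next
        case 3
        have "3 * ?z \<le> j * ?z" using 3 by simp
        moreover have "r * a = 5 * a" using 3 by simp
        ultimately show ?thesis using jz by linarith
      next
        \<comment> \<open>From here on the bound is an equality: with the gcd as unit it reads 3 + 2
          = 4 + 1, then 9 + 4 = 12 + 1, then 6 + 5 = 10 + 1.\<close>
        case 4
        then have "?z = 2 * a" using jz by simp
        moreover have "a dvd gcd (3 * a) (2 * a)" by simp
        ultimately show ?thesis using 4 a dvd_imp_le[of a "gcd (3 * a) ?z"] by simp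
      next
        case 5
        \<comment> \<open>\<open>4 * a = 3 * ?z\<close>, rearranged to exhibit \<open>a\<close> as a
          multiple of 3.\<close>
        then have "a = 3 * (?z - a)" using jz by simp
        then obtain c where "a = 3 * c" by blast
        moreover from this have "?z = 4 * c" using jz 5 by simp
        moreover have "c dvd gcd (3 * (3 * c)) (4 * c)" by simp
        ultimately show ?thesis using 5 a dvd_imp_le[of c "gcd (3 * a) ?z"] by simp
      next
        case 6
        then have "even (5 * a)" using jz by simp
        then obtain c where "a = 2 * c" by auto
        moreover from this have "?z = 5 * c" using jz 6 by simp
        moreover have "c dvd gcd (3 * (2 * c)) (5 * c)" by simp
        ultimately show ?thesis using 6 a dvd_imp_le[of c "gcd (3 * a) ?z"] by simp
      qed
    qed
    moreover have "periodic_upto ((!) ?w) (length ?w) ?z"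
      using periodic_word_power[of z j] j(2) by (metis length_word_power)
    ultimately have "length (u @ v) dvd ?z"
      using primitive_prefix_dvd_period[OF prim, of ?w ?z] fractional_power_period[OF \<open>m \<ge> 1\<close>, of u v]
        assms(3,4) z by simp
    then have "3 * a dvd r * a" using jz assms(3) by simp
    then show False using a assms(5) by simp
  qed
  then show ?thesis using uv \<open>m \<ge> 1\<close> by (cases m) (auto simp: primitive_word_def)
qed

section \<open>The pairs and their concatenations\<close>

text \<open>Moving the last \<open>v\<close> of the first word through the powers of
  \<open>u @ v\<close> turns them into powers of \<open>v @ u\<close>; it then meets the last
  \<open>u\<close>, which yields the extra factor.\<close>

lemma fractional_powers_append:
  "(word_power (v @ u) c @ v) @ (word_power (u @ v) d @ u) = word_power (v @ u) (c + d + 1)"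
  using word_power_swap[of v u d] by (simp only: word_power_add word_power_1 append_assoc) (metis append_assoc)

text \<open>With \<open>k = c + d + 1\<close>, which is \<open>3 * d + 1\<close> or
  \<open>3 * d + 2\<close>, the lengths of \<open>u @ v\<close> and of the two components are 3,
  \<open>2 * k\<close> and \<open>k\<close> times a common \<open>a\<close>. As 3 divides neither
  \<open>k\<close> nor \<open>2 * k\<close>, both components are primitive.\<close>

lemma eps2_pairs_fractional:
  assumes "u \<in> lists A" "v \<in> lists A" "u \<noteq> []" "v \<noteq> []" "d \<ge> 1" "primitive_word (u @ v)"
    and c: "c = 2 * d \<and> length v = 2 * length u \<or> c = 2 * d + 1 \<and> length u = 2 * length v"
    and l: "length (word_power (u @ v) d @ u) = l"
  shows "(word_power (v @ u) c @ v, word_power (u @ v) d @ u) \<in> eps2_pairs A l"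
proof -
  \<comment> \<open>\<open>a\<close> is the length of the shorter of \<open>u\<close> and
    \<open>v\<close>.\<close>
  obtain a where a: "length (v @ u) = 3 * a" "length (word_power (v @ u) c @ v) = 2 * l" "l = (c + d + 1) * a"
    "\<not> 3 dvd c + d + 1"
  proof (cases "c = 2 * d \<and> length v = 2 * length u")
    case True
    have "\<not> 3 dvd c + d + 1" using True by presburger
    then show thesis using that[of "length u"] True l by (simp add: algebra_simps)
  next
    case False
    have "\<not> 3 dvd c + d + 1" using False c by presburger
    then show thesis using that[of "length v"] False c l by (auto simp: algebra_simps)
  qed
  have "\<not> 3 dvd 2 * (c + d + 1)" using a(4) by presburger
  then have "primitive_word (word_power (v @ u) c @ v)"
    using a primitive_word_swap assms c
    by (intro primitive_fractional_power[where a = a and r = "2 * (c + d + 1)"]) (auto simp del: length_append)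
  moreover have "primitive_word (word_power (u @ v) d @ u)"
    using a assms by (intro primitive_fractional_power[where a = a and r = "c + d + 1"]) (auto simp: add.commute)
  moreover have "\<not> primitive_word ((word_power (v @ u) c @ v) @ (word_power (u @ v) d @ u))"
    unfolding fractional_powers_append primitive_word_def using assms(5) by (auto intro!: exI[of _ "v @ u"])
  moreover have "c > 0" using c \<open>d \<ge> 1\<close> by auto
  moreover have "word_power (v @ u) c @ v \<in> lists A" "word_power (u @ v) d @ u \<in> lists A"
    using assms \<open>c > 0\<close> by simp_all
  moreover have "\<exists>\<alpha> \<beta> s'. \<alpha> \<in> lists A \<and> \<beta> \<in> lists A \<and> \<alpha> \<noteq> [] \<and> \<beta> \<noteq> [] \<and> s' \<ge> 1 \<and>
        primitive_word (\<alpha> @ \<beta>) \<and>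
        word_power (u @ v) d @ u = word_power (\<alpha> @ \<beta>) s' @ \<alpha> \<and>
        ((word_power (v @ u) c @ v = word_power (\<beta> @ \<alpha>) (2 * s') @ \<beta> \<and> length \<beta> = 2 * length \<alpha>) \<or>
         (word_power (v @ u) c @ v = word_power (\<beta> @ \<alpha>) (2 * s' + 1) @ \<beta> \<and> length \<alpha> = 2 * length \<beta>))"
    by (rule exI[of _ u], rule exI[of _ v], rule exI[of _ d]) (use assms in blast)
  ultimately show ?thesis
    using a(2) l unfolding eps2_pairs_def by blast
qed

text \<open>A pair gives exponent \<open>3 * d + 1\<close> or \<open>3 * d + 2\<close> with
  \<open>d \<ge> 1\<close>. Conversely, the residue of the exponent modulo 3 tells which shape to
  use and where to cut the primitive root \<open>t\<close> into \<open>v @ u\<close>.\<close>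

lemma append_image_eps2_pairs:
  assumes "l > 0"
  shows "(\<lambda>(p, q). p @ q) ` eps2_pairs A l =
    {w \<in> lists A. length w = 3 * l \<and> 4 \<le> word_exponent w \<and> \<not> 3 dvd word_exponent w}"
proof (intro equalityI subsetI)
  fix w assume "w \<in> (\<lambda>(p, q). p @ q) ` eps2_pairs A l"
  then obtain p q where w: "w = p @ q" and pq: "(p, q) \<in> eps2_pairs A l" by auto
  then obtain u v d where uv: "d \<ge> 1" "primitive_word (u @ v)" "q = word_power (u @ v) d @ u"
    "p = word_power (v @ u) (2 * d) @ v \<or> p = word_power (v @ u) (2 * d + 1) @ v"
    unfolding eps2_pairs_def by blast
  then obtain c where c: "c = 2 * d \<or> c = 2 * d + 1" "p = word_power (v @ u) c @ v" by blast
  have "word_exponent w = c + d + 1"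
    unfolding w c(2) uv(3) fractional_powers_append
    using uv primitive_word_swap by (intro word_exponent_word_power) auto
  moreover have "c + d + 1 \<ge> 4" "\<not> 3 dvd c + d + 1" using c(1) uv(1) by presburger+
  ultimately show "w \<in> {w \<in> lists A. length w = 3 * l \<and> 4 \<le> word_exponent w \<and> \<not> 3 dvd word_exponent w}"
    using pq by (auto simp: w eps2_pairs_def)
next
  fix w assume "w \<in> {w \<in> lists A. length w = 3 * l \<and> 4 \<le> word_exponent w \<and> \<not> 3 dvd word_exponent w}"
  then have w: "w \<in> lists A" "length w = 3 * l" "4 \<le> word_exponent w" "\<not> 3 dvd word_exponent w" by auto
  then have "w \<noteq> []" using assms by auto
  then obtain t where t: "primitive_word t" "w = word_power t (word_exponent w)"
    using primitive_root by metis
  define k where "k = word_exponent w"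
  have k: "w = word_power t k" "4 \<le> k" "\<not> 3 dvd k" unfolding k_def by (fact t(2), fact w(3), fact w(4))
  have tA: "t \<in> lists A" using w(1) k by (simp add: k(1))
  have len: "3 * l = k * length t" using w(2) k(1) by simp
  then have "3 dvd k * length t" by (metis dvd_triv_left)
  then have "3 dvd length t" using k(3) by (simp add: prime_dvd_mult_iff)
  then obtain a where a: "length t = 3 * a" by (auto simp: dvd_def)
  then have l: "l = k * a" using len by simp
  then have "a > 0" using assms by simp
  \<comment> \<open>\<open>d\<close> is \<open>k div 3\<close>, positive because
    \<open>k \<ge> 4\<close>; \<open>b\<close> is to be the length of \<open>v\<close>, two thirds
    of \<open>t\<close> for remainder 1 and one third for remainder 2.\<close>
  obtain d c b where d: "d \<ge> 1" "c + d + 1 = k" "c = 2 * d \<and> b = 2 * a \<or> c = 2 * d + 1 \<and> b = a"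
  proof (cases "k mod 3 = 1")
    case True
    then have "2 * (k div 3) + k div 3 + 1 = k" "k div 3 \<ge> 1" using k(2) by presburger+
    then show thesis using that by blast
  next
    case False
    then have "2 * (k div 3) + 1 + k div 3 + 1 = k" "k div 3 \<ge> 1" using k(2,3) by presburger+
    then show thesis using that by blast
  qed
  define v u where "v = take b t" and "u = drop b t"
  have vu: "v @ u = t" "length v = b" "length u = 3 * a - b"
    using a d(3) by (auto simp: u_def v_def)
  have uv: "u \<in> lists A" "v \<in> lists A" "u \<noteq> []" "v \<noteq> []"
  proof -
    show "u \<in> lists A" "v \<in> lists A" using tA unfolding vu(1)[symmetric] by simp_all
    show "u \<noteq> []" "v \<noteq> []" using vu(2,3) d(3) \<open>a > 0\<close> by auto
  qed
  have "primitive_word (u @ v)" using t(1) vu(1) primitive_word_swap by blast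
  moreover have "length (word_power (u @ v) d @ u) = l"
    using vu(2,3) d(3) by (auto simp: l algebra_simps simp flip: d(2))
  ultimately have "(word_power (v @ u) c @ v, word_power (u @ v) d @ u) \<in> eps2_pairs A l"
    using uv d(1,3) vu(2,3) by (intro eps2_pairs_fractional) auto
  moreover have "w = (word_power (v @ u) c @ v) @ (word_power (u @ v) d @ u)"
    by (simp only: fractional_powers_append) (simp only: vu(1) d(2) k(1))
  ultimately show "w \<in> (\<lambda>(p, q). p @ q) ` eps2_pairs A l" by (metis (no_types, lifting) case_prod_conv image_eqI)
qed

lemma eps2_eq_card:
  assumes "l > 0"
  shows "eps2 A l =
    card {w \<in> lists A. length w = 3 * l \<and> 4 \<le> word_exponent w \<and> \<not> 3 dvd word_exponent w}"
proof -
  \<comment> \<open>The cut in \<open>p @ q\<close> is at the fixed position \<open>2 * l\<close>,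
    so the concatenation determines the pair.\<close>
  have "inj_on (\<lambda>(p, q). p @ q) (eps2_pairs A l)"
    by (auto simp: inj_on_def eps2_pairs_def)
  then show ?thesis
    by (metis append_image_eps2_pairs[OF assms] card_image eps2_def)
qed

section \<open>Inclusion and exclusion\<close>

text \<open>Raising to the \<open>x\<close>-th power is injective on words of length
  \<open>N div x\<close>, since the base is a prefix of its power.\<close>

lemma card_powers:
  assumes "finite A" "x > 0" "x dvd N"
  shows "card {w \<in> lists A. length w = N \<and> (\<exists>v. w = word_power v x)} = card A ^ (N div x)"
proof -
  let ?V = "{v. set v \<subseteq> A \<and> length v = N div x}"
  have "{w \<in> lists A. length w = N \<and> (\<exists>v. w = word_power v x)} = (\<lambda>v. word_power v x) ` ?V"
  proof (intro equalityI subsetI)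
    fix w assume "w \<in> {w \<in> lists A. length w = N \<and> (\<exists>v. w = word_power v x)}"
    then obtain v where w: "w \<in> lists A" "length w = N" and v: "w = word_power v x" by blast
    then have "x * length v = N" "word_power v x \<in> lists A" by auto
    then have "length v = N div x" "v \<in> lists A" using assms(2) by auto
    then show "w \<in> (\<lambda>v. word_power v x) ` ?V" using v \<open>v \<in> lists A\<close> by auto
  next
    fix w assume "w \<in> (\<lambda>v. word_power v x) ` ?V"
    then obtain v where v: "v \<in> lists A" "length v = N div x" "w = word_power v x"
      by auto
    then have "w \<in> lists A" "length w = N" using assms by simp_all
    then show "w \<in> {w \<in> lists A. length w = N \<and> (\<exists>v. w = word_power v x)}" using v(3) by blast
  qed
  moreover have "inj_on (\<lambda>v. word_power v x) ?V"
  proof (rule inj_onI)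
    fix v v' assume "v \<in> ?V" "v' \<in> ?V" "word_power v x = word_power v' x"
    then show "v = v'" using assms(2) by (cases x) auto
  qed
  ultimately show ?thesis
    using card_lists_length_eq[OF assms(1), of "N div x"] by (simp add: card_image)
qed

lemma prod_dvd_iff_pairwise_coprime:
  fixes L :: "nat set"
  assumes "finite L" "pairwise coprime L"
  shows "\<Prod>L dvd k \<longleftrightarrow> (\<forall>x\<in>L. x dvd k)"
  using assms
proof (induction L rule: finite_induct)
  case (insert x L)
  then have "coprime x (\<Prod>L)"
    by (intro prod_coprime_right) (auto simp: pairwise_insert)
  then have "x * \<Prod>L dvd k \<longleftrightarrow> x dvd k \<and> \<Prod>L dvd k"
    by (meson divides_mult dvd_mult_left dvd_mult_right)
  then show ?case using insert by (simp add: pairwise_insert)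
qed simp

text \<open>Expansion of \<open>(1 - 1) ^ card D\<close>, with one further sign from the exponent
  \<open>card L + 1\<close>.\<close>

lemma sum_alternating_Pow:
  assumes "finite D"
  shows "(\<Sum>L\<in>Pow D. (- 1) ^ (card L + 1)) = (if D = {} then - 1 else 0 :: int)"
proof -
  have "(\<Sum>L\<in>Pow D. (- 1) ^ card L) = (0 :: int) ^ card D"
    using prod_diff_conv_sum[OF assms, of "\<lambda>_. 1 :: int" "\<lambda>_. 1"] by simp
  then show ?thesis using assms by (simp add: sum_negf card_gt_0_iff)
qed

text \<open>Leaving out \<open>{}\<close> adds 1 to the full sum; leaving out \<open>{x}\<close>, if
  it is a subset of \<open>D\<close>, takes 1 away again.\<close>

lemma sum_alternating_Pow_minus:
  assumes "finite D"
  shows "(\<Sum>L\<in>Pow D - {{}, {x}}. (- 1) ^ (card L + 1)) = (of_bool (x \<notin> D \<and> D \<noteq> {}) :: int)"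
proof -
  have "(\<Sum>L\<in>Pow D - {{}, {x}}. (- 1) ^ (card L + 1)) =
      (\<Sum>L\<in>Pow D. (- 1) ^ (card L + 1)) - (\<Sum>L\<in>Pow D \<inter> {{}, {x}}. (- 1) ^ (card L + 1) :: int)"
    using assms by (subst sum.Int_Diff[of "Pow D" _ "{{}, {x}}"]) auto
  moreover have "Pow D \<inter> {{}, {x}} = (if x \<in> D then {{}, {x}} else {{}})" by auto
  ultimately show ?thesis
    by (simp add: sum_alternating_Pow[OF assms, simplified])
qed

text \<open>Each power of \<open>card A\<close> counts the words whose exponent is divisible by
  \<open>\<Prod>L\<close>. After exchanging the sums, every word contributes the alternating sum
  over the subsets of its own set \<open>?D\<close> of divisors in \<open>S\<close>.\<close>

lemma card_words_inclusion_exclusion: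
  fixes S :: "nat set"
  assumes "finite A" "finite S" "pairwise coprime S" "\<And>x. x \<in> S \<Longrightarrow> x dvd N" "N > 0" "y \<in> S"
  shows "(\<Sum>L | L \<subseteq> S \<and> L \<noteq> {} \<and> L \<noteq> {y}. (- 1) ^ (card L + 1) * int (card A) ^ (N div \<Prod>L)) =
    int (card {w \<in> lists A. length w = N \<and> \<not> y dvd word_exponent w \<and> (\<exists>x\<in>S. x dvd word_exponent w)})"
proof -
  let ?F = "{L. L \<subseteq> S \<and> L \<noteq> {} \<and> L \<noteq> {y}}"
  define W where "W = {w \<in> lists A. length w = N}"
  have W: "finite W" unfolding W_def using finite_lists_length_eq[OF assms(1)] by (simp add: lists_eq_set)
  have F: "finite ?F" using assms(2) by simp
  have prod_iff: "\<Prod>L dvd k \<longleftrightarrow> (\<forall>x\<in>L. x dvd k)" if "L \<subseteq> S" for L k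
    using that assms(2,3) by (intro prod_dvd_iff_pairwise_coprime) (auto intro: finite_subset pairwise_subset)
  have "(\<Sum>L\<in>?F. (- 1) ^ (card L + 1) * int (card A) ^ (N div \<Prod>L)) =
    (\<Sum>L\<in>?F. \<Sum>w\<in>W. (- 1) ^ (card L + 1) * of_bool (\<Prod>L dvd word_exponent w))"
  proof (rule sum.cong[OF refl])
    fix L assume "L \<in> ?F"
    then have dvd: "\<Prod>L dvd N" using prod_iff assms(4) by auto
    then have pos: "\<Prod>L > 0" using assms(5) by (auto intro: Nat.gr0I)
    have "{w \<in> lists A. length w = N \<and> (\<exists>v. w = word_power v (\<Prod>L))} =
        W \<inter> {w. \<Prod>L dvd word_exponent w}"
      using is_power_iff_dvd_exponent[OF _ pos] assms(5) by (auto simp: W_def)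
    then have "int (card A) ^ (N div \<Prod>L) = (\<Sum>w\<in>W. of_bool (\<Prod>L dvd word_exponent w))"
      using card_powers[OF assms(1) pos dvd] W by simp
    then show "(- 1) ^ (card L + 1) * int (card A) ^ (N div \<Prod>L) =
      (\<Sum>w\<in>W. (- 1) ^ (card L + 1) * of_bool (\<Prod>L dvd word_exponent w))"
      by (simp only: sum_distrib_left)
  qed
  also have "\<dots> = (\<Sum>w\<in>W. \<Sum>L\<in>?F. (- 1) ^ (card L + 1) * of_bool (\<Prod>L dvd word_exponent w))"
    by (rule sum.swap)
  also have "\<dots> = (\<Sum>w\<in>W. of_bool (\<not> y dvd word_exponent w \<and> (\<exists>x\<in>S. x dvd word_exponent w)))"
  proof (rule sum.cong[OF refl])
    fix w
    let ?D = "{x \<in> S. x dvd word_exponent w}"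
    have "(\<Sum>L\<in>?F. (- 1) ^ (card L + 1) * of_bool (\<Prod>L dvd word_exponent w)) =
        (\<Sum>L\<in>Pow ?D - {{}, {y}}. (- 1) ^ (card L + 1) :: int)"
    \<comment> \<open>By pairwise coprimality \<open>\<Prod>L\<close> divides the exponent exactly
      when \<open>L \<subseteq> ?D\<close>; all other terms vanish.\<close>
    proof (rule sum.mono_neutral_cong_right[OF F])
      have "\<Prod>L dvd word_exponent w \<longleftrightarrow> L \<subseteq> ?D" if "L \<in> ?F" for L
        using that by (subst prod_iff) auto
      then show "\<forall>L\<in>?F - (Pow ?D - {{}, {y}}). (- 1) ^ (card L + 1) * of_bool (\<Prod>L dvd word_exponent w) = (0 :: int)"
        by auto
      fix L assume "L \<in> Pow ?D - {{}, {y}}"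
      then show "(- 1) ^ (card L + 1) * of_bool (\<Prod>L dvd word_exponent w) = ((- 1) ^ (card L + 1) :: int)"
        using prod_iff[of L] by auto
    qed auto
    also have "\<dots> = of_bool (\<not> y dvd word_exponent w \<and> (\<exists>x\<in>S. x dvd word_exponent w))"
      using assms(2,6) by (subst sum_alternating_Pow_minus) auto
    finally show "(\<Sum>L\<in>?F. (- 1) ^ (card L + 1) * of_bool (\<Prod>L dvd word_exponent w)) =
      (of_bool (\<not> y dvd word_exponent w \<and> (\<exists>x\<in>S. x dvd word_exponent w)) :: int)" .
  qed
  also have "\<dots> = int (card (W \<inter> {w. \<not> y dvd word_exponent w \<and> (\<exists>x\<in>S. x dvd word_exponent w)}))"
    using W by simp
  also have "W \<inter> {w. \<not> y dvd word_exponent w \<and> (\<exists>x\<in>S. x dvd word_exponent w)} =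
    {w \<in> lists A. length w = N \<and> \<not> y dvd word_exponent w \<and> (\<exists>x\<in>S. x dvd word_exponent w)}"
    by (auto simp: W_def)
  finally show ?thesis .
qed

section \<open>Exponents of at least 4 and the two formulas\<close>

lemma prime_factors_ge_5:
  fixes l1 :: nat
  assumes "coprime 3 l1" "coprime 2 l1" "p \<in> prime_factors l1"
  shows "p \<ge> 5"
proof -
  have p: "prime p" "p dvd l1" using assms(3) by auto
  have "p \<noteq> 2" "p \<noteq> 3" using assms p by (metis coprime_common_divisor not_prime_unit dvd_refl)+
  moreover have "p \<noteq> 4" using p(1) by (metis \<open>p \<noteq> 2\<close> even_numeral primes_dvd_imp_eq two_is_prime_nat)
  ultimately show ?thesis using prime_ge_2_nat[OF p(1)] by linarith
qed

text \<open>If \<open>k\<close> shares no prime with \<open>l1\<close>, then it divides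
  \<open>2 ^ s\<close>, because 3 does not divide it; a power of 2 that is at least 4 is a multiple
  of 4 and forces \<open>s \<ge> 2\<close>. Conversely, all the listed divisors are at least
  4.\<close>

lemma ge_4_iff_dvd:
  fixes l1 m s k :: nat
  assumes cop: "coprime 3 l1" "coprime 2 l1" and "k dvd 3 ^ m * 2 ^ s * l1" "k > 0" "\<not> 3 dvd k"
  shows "k \<ge> 4 \<longleftrightarrow> (s \<ge> 2 \<and> 4 dvd k) \<or> (\<exists>p\<in>prime_factors l1. p dvd k)"
proof
  assume k: "k \<ge> 4"
  show "(s \<ge> 2 \<and> 4 dvd k) \<or> (\<exists>p\<in>prime_factors l1. p dvd k)"
  proof (cases "coprime k l1")
    case True
    moreover have "coprime k (3 ^ m)"
      using assms(5) prime_imp_coprime[of 3 k] by (simp add: coprime_commute)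
    ultimately have "k dvd 2 ^ s"
      using assms(3) by (metis coprime_dvd_mult_left_iff coprime_dvd_mult_right_iff)
    then obtain i where i: "i \<le> s" "k = 2 ^ i"
      using divides_primepow_nat two_is_prime_nat by blast
    have "i \<ge> 2"
    proof (rule ccontr)
      assume "\<not> i \<ge> 2"
      then have "i = 0 \<or> i = 1" by linarith
      then show False using k i by auto
    qed
    then have "2 ^ 2 dvd k" unfolding i(2) by (rule le_imp_power_dvd)
    then show ?thesis using i \<open>i \<ge> 2\<close> by simp
  next
    case False
    then obtain c where "c dvd k" "c dvd l1" "c \<noteq> 1" by (auto elim: not_coprimeE)
    then obtain p where "prime p" "p dvd k" "p dvd l1"
      using prime_factor_nat[of c] dvd_trans by metis
    moreover have "l1 \<noteq> 0" using cop by (intro notI) simp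
    ultimately show ?thesis by (auto simp: prime_factors_dvd)
  qed
next
  assume "(s \<ge> 2 \<and> 4 dvd k) \<or> (\<exists>p\<in>prime_factors l1. p dvd k)"
  then show "k \<ge> 4"
    using assms(4) prime_factors_ge_5[OF cop] by (auto dest!: dvd_imp_le intro: order_trans) fastforce
qed

theorem theorem3p13:
  fixes A :: "'a set" and n l m s l1 :: nat
  assumes "finite A" and "card A = n" and "n \<ge> 2"
    and "l = 3 ^ m * 2 ^ s * l1" and "l > 0"
    and "gcd 3 l1 = 1" and "gcd 2 l1 = 1"
  shows "(s \<ge> 2 \<longrightarrow>
            int (eps2 A l) = (\<Sum>L\<in>Gamma1 l1. (- 1) ^ (card L + 1) * int n ^ (3 * l div \<Prod>L))) \<and>
         (s \<le> 1 \<longrightarrow>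
            int (eps2 A l) = (\<Sum>L\<in>Gamma2 l1. (- 1) ^ (card L + 1) * int n ^ (3 * l div \<Prod>L)))"
proof -
  have cop: "coprime 3 l1" "coprime 2 l1" using assms by (simp_all add: coprime_iff_gcd_eq_1)
  \<comment> \<open>One index set for both formulas: 4 belongs to it exactly when
    \<open>s \<ge> 2\<close>.\<close>
  define S where "S = {3} \<union> (if s \<ge> 2 then {4} else {}) \<union> prime_factors l1"
  have "coprime x y" if "x \<in> prime_factors l1" "y = 3 \<or> y = 4" for x y
    using that(2)
  proof
    have x: "coprime c x" if "coprime c l1" for c
      using \<open>x \<in> prime_factors l1\<close> that by (meson coprime_divisors dvd_refl in_prime_factors_imp_dvd)
    show "coprime x y" if "y = 3" using that x[OF cop(1)] by (simp add: coprime_commute)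
    have "coprime (2 * 2) x" using x[OF cop(2)] by (simp only: coprime_mult_left_iff)
    then show "coprime x y" if "y = 4" using that by (simp add: coprime_commute)
  qed
  moreover have "coprime (3::nat) 4" by (simp add: coprime_iff_gcd_eq_1 gcd_non_0_nat)
  ultimately have "pairwise coprime S"
    unfolding S_def pairwise_def by (auto simp: coprime_commute intro: primes_coprime in_prime_factors_imp_prime)
  \<comment> \<open>The factor 3 of \<open>3 * l\<close> covers \<open>x = 3\<close> even for
    \<open>m = 0\<close>; 4 divides \<open>2 ^ s\<close> when it belongs to
    \<open>S\<close>.\<close>
  moreover have "x dvd 3 * l" if "x \<in> S" for x
    using that le_imp_power_dvd[of 2 s "2::nat"]
    by (auto simp: S_def assms(4) intro: dvd_mult dvd_mult2 split: if_splits)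
  ultimately have "(\<Sum>L | L \<subseteq> S \<and> L \<noteq> {} \<and> L \<noteq> {3}. (- 1) ^ (card L + 1) * int n ^ (3 * l div \<Prod>L)) =
    int (card {w \<in> lists A. length w = 3 * l \<and> \<not> 3 dvd word_exponent w \<and> (\<exists>x\<in>S. x dvd word_exponent w)})"
    using card_words_inclusion_exclusion[of A S "3 * l" 3] assms(1,2,5) by (simp add: S_def)
  also have "{w \<in> lists A. length w = 3 * l \<and> \<not> 3 dvd word_exponent w \<and> (\<exists>x\<in>S. x dvd word_exponent w)} =
    {w \<in> lists A. length w = 3 * l \<and> 4 \<le> word_exponent w \<and> \<not> 3 dvd word_exponent w}"
  proof -
    have "(\<exists>x\<in>S. x dvd word_exponent w) \<longleftrightarrow> 4 \<le> word_exponent w"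
      if w: "length w = 3 * l" "\<not> 3 dvd word_exponent w" for w :: "'a list"
    proof -
      have "w \<noteq> []" using w(1) assms(5) by auto
      then obtain t where t: "word_exponent w > 0" "w = word_power t (word_exponent w)"
        using primitive_root by metis
      have "word_exponent w dvd length w"
        using arg_cong[OF t(2), of length] by (metis dvd_triv_left length_word_power)
      \<comment> \<open>The words have length \<open>3 * l\<close>, hence \<open>m + 1\<close> in
        place of \<open>m\<close>.\<close>
      then have "word_exponent w dvd 3 ^ (m + 1) * 2 ^ s * l1"
        by (simp add: w(1) assms(4) mult.assoc)
      from ge_4_iff_dvd[OF cop this t(1) w(2)] show ?thesis
        using w(2) by (auto simp: S_def split: if_splits)
    qed
    then show ?thesis by blast
  qed
  finally show ?thesis
    using eps2_eq_card[OF assms(5), of A]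
    by (auto simp: S_def Gamma1_def Gamma2_def insert_commute)
qed

end
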